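(* Let $\psi\in\mathbb{R}[\bm{x},t]$ be a polynomial satisfying the sum-of-squares constraints (SOS) given in the context. Then $\{\bm{x}\in B(\bm{0},R)\mid\psi(\bm{x},0)\le0\}$ is an inner-approximation of the backward reachable set, i.e. $\{\bm{x}\in B(\bm{0},R)\mid\psi(\bm{x},0)\le0\}\subseteq\mathcal{R}_0$.
   Context: Setting. $n,m$ are positive integers, $T>0$. $\bm{f}:\mathbb{R}^n\times\mathbb{R}^m\to\mathbb{R}^n$ has polynomial components $f_i\in\mathbb{R}[\bm{x},\bm{d}]$. $\mathcal{D}=\{\bm{d}\in\mathbb{R}^m\mid h_i(\bm{d})\ge0,\ i=1,\dots,n_{\mathcal{D}}\}$ is a (nonempty) compact set with $h_i\in\mathbb{R}[\bm{d}]$. For $t\in[0,T]$, $\mathcal{X}_t=\{\bm{x}\in\mathbb{R}^n\mid g_i(\bm{x},t)\le0,\ i=1,\dots,n_{\mathcal{X}}\}$ is compact, with $g_i\in\mathbb{R}[\bm{x},t]$ and $\partial\mathcal{X}_t=\bigcup_{i}\{\bm{x}\in\mathcal{X}_t\mid g_i(\bm{x},t)=0\}$. The target is $\mathtt{TR}=\{\bm{x}\in\mathbb{R}^n\mid l_i(\bm{x})\le0,\ i=1,\dots,n_{\mathtt{TR}}\}$ with $l_i\in\mathbb{R}[\bm{x}]$ and $\partial\mathtt{TR}=\bigcup_i\{\bm{x}\in\mathtt{TR}\mid l_i(\bm{x})=0\}$. $R>0$ is a number and $B(\bm{0},R)=\{\bm{x}\in\mathbb{R}^n\mid g_R(\bm{x})\ge0\}$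 with $g_R(\bm{x})=R-\sum_{i=1}^n x_i^2$, chosen so that for all $t\in[0,T]$: $\mathcal{X}_t\subseteq B(\bm{0},R)$ and $\partial\mathcal{X}_t\cap\partial B(\bm{0},R)=\emptyset$. $\mathcal{M}_0$ is the set of measurable functions $\bm{d}:[0,T]\to\mathcal{D}$; for $\bm{d}\in\mathcal{M}_0$, $\bm{y}_{\bm{x}_0,0}^{\bm{d}}$ is the absolutely continuous solution of $\dot{\bm{x}}(s)=\bm{f}(\bm{x}(s),\bm{d}(s))$ a.e. with value $\bm{x}_0$ at time $0$. Backward reachable set: $\mathcal{R}_0=\{\bm{x}_0\in\mathbb{R}^n\mid \forall\bm{d}\in\mathcal{M}_0:\ \bm{y}_{\bm{x}_0,0}^{\bm{d}}(s)\in\mathcal{X}_s\ \forall s\in[0,T]\text{ and }\bm{y}_{\bm{x}_0,0}^{\bm{d}}(T)\in\mathtt{TR}\}$ (in particular the solution is required to exist on $[0,T]$). A polynomial $\psi\in\mathbb{R}[\bm{x},t]$ satisfies (SOS) if there exist sum-of-squares polynomials $s_0,s_1,s_2,s'_r$ ($r=1,\dots,n_{\mathcal{D}}$) in $(\bm{x},t,\bm{d})$, $s_{3,i},s_{4,i},s_{5,i}$ ($i=1,\dots,n_{\mathcal{X}}$) in $(\bm{x},t)$, and $s_{6,j},s_{7,j}$ ($j=1,\dots,n_{\mathtt{TR}}$) in $\bm{x}$ such that, as polynomial identities, \[-\big(\partial_t\psi(\bm{x},t)+\nabla_{\bm{x}}\psi(\bm{x},t)\cdot\bm{f}(\bm{x},\bm{d})\big)=s_0+s_1g_R(\bm{x})+s_2\,t(T-t)+\sum_{r=1}^{n_{\mathcal{D}}}s'_r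 h_r(\bm{d}),\] \[\psi(\bm{x},t)-g_i(\bm{x},t)=s_{3,i}+s_{4,i}g_R(\bm{x})+s_{5,i}\,t(T-t),\quad i=1,\dots,n_{\mathcal{X}},\] \[\psi(\bm{x},T)-l_j(\bm{x})=s_{6,j}+s_{7,j}g_R(\bm{x}),\quad j=1,\dots,n_{\mathtt{TR}}.\] *)

theory Defs
  imports "HOL-Analysis.Analysis"
begin

text \<open>
  Since \<open>\<real>\<close> is infinite, polynomials in several real variables are identified with the functions
  they induce: \<^const>\<open>real_polynomial_function\<close> on \<open>real ^ 'n\<close>, \<open>(real ^ 'n) \<times> real\<close> and
  \<open>(real ^ 'n) \<times> real \<times> (real ^ 'm)\<close> for polynomials in \<open>x\<close>, \<open>(x, t)\<close> and \<open>(x, t, d)\<close>. Polynomial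
  identities become identities at all points of the whole space. A family of \<open>k\<close> polynomials is a
  function on \<^typ>\<open>nat\<close> of which only the values at \<open>{1..k}\<close> matter.
\<close>

definition sos :: "('a::real_normed_vector \<Rightarrow> real) \<Rightarrow> bool" where
  "sos p \<longleftrightarrow> (\<exists>(k::nat) q. (\<forall>i<k. real_polynomial_function (q i)) \<and> (\<forall>z. p z = (\<Sum>i<k. (q i z)\<^sup>2)))"


subsection \<open>The sets\<close>

definition disturbance_set :: "nat \<Rightarrow> (nat \<Rightarrow> real ^ 'm \<Rightarrow> real) \<Rightarrow> (real ^ 'm) set" where
  "disturbance_set nD h = {d. \<forall>i\<in>{1..nD}. 0 \<le> h i d}"

definition state_set :: "nat \<Rightarrow> (nat \<Rightarrow> (real ^ 'n) \<times> real \<Rightarrow> real) \<Rightarrow> real \<Rightarrow> (real ^ 'n) set" where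
  "state_set nX g t = {x. \<forall>i\<in>{1..nX}. g i (x, t) \<le> 0}"

text \<open>
  The boundary of \<open>state_set nX g t\<close> is the set of its points where some constraint is active. For
  continuous \<open>g i\<close> it contains the topological frontier.
\<close>

definition state_boundary :: "nat \<Rightarrow> (nat \<Rightarrow> (real ^ 'n) \<times> real \<Rightarrow> real) \<Rightarrow> real \<Rightarrow> (real ^ 'n) set" where
  "state_boundary nX g t = (\<Union>i\<in>{1..nX}. {x \<in> state_set nX g t. g i (x, t) = 0})"

definition target_set :: "nat \<Rightarrow> (nat \<Rightarrow> real ^ 'n \<Rightarrow> real) \<Rightarrow> (real ^ 'n) set" where
  "target_set nTR l = {x. \<forall>i\<in>{1..nTR}. l i x \<le> 0}"

definition g_ball :: "real \<Rightarrow> real ^ 'n \<Rightarrow> real" where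
  "g_ball R x = R - (\<Sum>i\<in>UNIV. (x $ i)\<^sup>2)"

text \<open>The Euclidean ball around the origin whose radius is \<open>sqrt R\<close>, not \<open>R\<close>.\<close>

definition B_set :: "real \<Rightarrow> (real ^ 'n) set" where
  "B_set R = {x. 0 \<le> g_ball R x}"


subsection \<open>Trajectories and the backward reachable set\<close>

definition absolutely_continuous_on_interval ::
    "real \<Rightarrow> real \<Rightarrow> (real \<Rightarrow> 'a::metric_space) \<Rightarrow> bool" where
  "absolutely_continuous_on_interval u v y \<longleftrightarrow>
     (\<forall>\<epsilon>>0. \<exists>\<delta>>0. \<forall>(k::nat) a b.
        (\<forall>i<k. u \<le> a i \<and> a i \<le> b i \<and> b i \<le> v) \<longrightarrow>
        disjoint_family_on (\<lambda>i. {a i<..<b i}) {..<k} \<longrightarrow>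
        (\<Sum>i<k. b i - a i) < \<delta> \<longrightarrow>
        (\<Sum>i<k. dist (y (a i)) (y (b i))) < \<epsilon>)"

text \<open>Values of inputs and of trajectories outside \<open>{0..T}\<close> are irrelevant.\<close>

definition admissible_inputs :: "real \<Rightarrow> (real ^ 'm) set \<Rightarrow> (real \<Rightarrow> real ^ 'm) set" where
  "admissible_inputs T D =
     {d. d \<in> borel_measurable (lebesgue_on {0..T}) \<and> (\<forall>s\<in>{0..T}. d s \<in> D)}"

definition is_trajectory ::
    "((real ^ 'n) \<times> (real ^ 'm) \<Rightarrow> real ^ 'n) \<Rightarrow> real \<Rightarrow> (real \<Rightarrow> real ^ 'm) \<Rightarrow> real ^ 'n \<Rightarrow>
     (real \<Rightarrow> real ^ 'n) \<Rightarrow> bool" where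
  "is_trajectory f T d x0 y \<longleftrightarrow>
     y 0 = x0 \<and>
     absolutely_continuous_on_interval 0 T y \<and>
     (AE s in lebesgue_on {0..T}. (y has_vector_derivative f (y s, d s)) (at s within {0..T}))"

text \<open>
  The trajectory is required to exist on all of \<open>{0..T}\<close>. Quantifying over every trajectory, instead
  of speaking of the one that starts at \<open>x0\<close>, avoids building its uniqueness into the definition.
\<close>

definition backward_reachable_set ::
    "((real ^ 'n) \<times> (real ^ 'm) \<Rightarrow> real ^ 'n) \<Rightarrow> real \<Rightarrow> (real ^ 'm) set \<Rightarrow> (real \<Rightarrow> (real ^ 'n) set) \<Rightarrow>
     (real ^ 'n) set \<Rightarrow> (real ^ 'n) set" where
  "backward_reachable_set f T D X TR =
     {x0. \<forall>d\<in>admissible_inputs T D.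
        (\<exists>y. is_trajectory f T d x0 y) \<and>
        (\<forall>y. is_trajectory f T d x0 y \<longrightarrow> (\<forall>s\<in>{0..T}. y s \<in> X s) \<and> y T \<in> TR)}"


subsection \<open>The sum-of-squares constraints\<close>

definition partial_t :: "((real ^ 'n) \<times> real \<Rightarrow> real) \<Rightarrow> real ^ 'n \<Rightarrow> real \<Rightarrow> real" where
  "partial_t \<psi> x t = deriv (\<lambda>\<tau>. \<psi> (x, \<tau>)) t"

definition grad_x :: "((real ^ 'n) \<times> real \<Rightarrow> real) \<Rightarrow> real ^ 'n \<Rightarrow> real \<Rightarrow> real ^ 'n" where
  "grad_x \<psi> x t = (\<chi> i. deriv (\<lambda>u. \<psi> (x + u *\<^sub>R axis i 1, t)) 0)"

definition SOS_constraints ::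
    "((real ^ 'n) \<times> (real ^ 'm) \<Rightarrow> real ^ 'n) \<Rightarrow> real \<Rightarrow> real \<Rightarrow>
     nat \<Rightarrow> (nat \<Rightarrow> real ^ 'm \<Rightarrow> real) \<Rightarrow>
     nat \<Rightarrow> (nat \<Rightarrow> (real ^ 'n) \<times> real \<Rightarrow> real) \<Rightarrow>
     nat \<Rightarrow> (nat \<Rightarrow> real ^ 'n \<Rightarrow> real) \<Rightarrow>
     ((real ^ 'n) \<times> real \<Rightarrow> real) \<Rightarrow> bool" where
  "SOS_constraints f T R nD h nX g nTR l \<psi> \<longleftrightarrow>
     (\<exists>(s0 :: (real ^ 'n) \<times> real \<times> (real ^ 'm) \<Rightarrow> real) s1 s2
       (s' :: nat \<Rightarrow> (real ^ 'n) \<times> real \<times> (real ^ 'm) \<Rightarrow> real)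
       (s3 :: nat \<Rightarrow> (real ^ 'n) \<times> real \<Rightarrow> real) s4 s5
       (s6 :: nat \<Rightarrow> real ^ 'n \<Rightarrow> real) s7.
        sos s0 \<and> sos s1 \<and> sos s2 \<and> (\<forall>r\<in>{1..nD}. sos (s' r)) \<and>
        (\<forall>i\<in>{1..nX}. sos (s3 i) \<and> sos (s4 i) \<and> sos (s5 i)) \<and>
        (\<forall>j\<in>{1..nTR}. sos (s6 j) \<and> sos (s7 j)) \<and>
        (\<forall>x t d. - (partial_t \<psi> x t + grad_x \<psi> x t \<bullet> f (x, d)) =
           s0 (x, t, d) + s1 (x, t, d) * g_ball R x + s2 (x, t, d) * (t * (T - t))
           + (\<Sum>r\<in>{1..nD}. s' r (x, t, d) * h r d)) \<and>
        (\<forall>i\<in>{1..nX}. \<forall>x t. \<psi> (x, t) - g i (x, t) =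
           s3 i (x, t) + s4 i (x, t) * g_ball R x + s5 i (x, t) * (t * (T - t))) \<and>
        (\<forall>j\<in>{1..nTR}. \<forall>x. \<psi> (x, T) - l j x = s6 j x + s7 j x * g_ball R x))"

end

theory Submission
  imports Defs
begin

text \<open>
  As long as a trajectory \<open>y\<close> stays in the ball, the first constraint makes \<open>\<psi> (y s, s)\<close>
  nonincreasing, so it stays nonpositive and the second constraint puts \<open>y s\<close> into the state set.
  The state set lies in the interior of the ball, because its boundary misses the sphere; hence
  \<open>y\<close> can never reach the sphere. Existence of a trajectory on all of \<open>{0..T}\<close> follows by
  solving the globally Lipschitz equation with right-hand side \<open>f (closest_point B x, d)\<close>: by the
  same argument its solution stays in the ball, where both equations agree.
\<close>

text \<open>Inputs are only measurable, so trajectories are absolutely continuous and obey the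
  equation only almost everywhere. Monotonicity of \<psi> along them therefore cannot come from the
  mean value theorem, and existence has to be of Caratheodory type, through an integral equation.
  Moreover a polynomial field is only locally Lipschitz, and its solutions may blow up before
  \<open>T\<close>. The ball serves as the trap, rather than the state sets, because it does not
  depend on time and is convex. Landing in its interior, not merely in it, is what breaks the
  circle: the sign of the derivative is known only inside the ball, and a trajectory on the sphere
  could leave immediately afterwards. One invariance statement, which asks for the equation only at
  times spent in the ball, serves both the projected solution and an arbitrary trajectory. Hence
  uniqueness of solutions never enters.\<close>

section \<open>Calculus of absolutely continuous functions\<close>

text \<open>The gauge argument applies the estimate to a set of tagged intervals, so the index set
  \<open>{..<k}\<close> of the definition is traded for any finite set along an enumeration.\<close>

lemma ac_on_finite_family:
  fixes y :: "real \<Rightarrow> 'a::metric_space"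
  assumes "absolutely_continuous_on_interval u v y" "\<epsilon> > 0"
  obtains \<delta> where "\<delta> > 0"
    "\<And>(I :: 'i set) a b. \<lbrakk>finite I; \<And>i. i \<in> I \<Longrightarrow> u \<le> a i \<and> a i \<le> b i \<and> b i \<le> v;
       disjoint_family_on (\<lambda>i. {a i<..<b i}) I; (\<Sum>i\<in>I. b i - a i) < \<delta>\<rbrakk>
       \<Longrightarrow> (\<Sum>i\<in>I. dist (y (a i)) (y (b i))) < \<epsilon>"
proof -
  obtain \<delta> where "\<delta> > 0" and \<delta>: "\<And>(k::nat) a b. \<lbrakk>\<forall>i<k. u \<le> a i \<and> a i \<le> b i \<and> b i \<le> v;
      disjoint_family_on (\<lambda>i. {a i<..<b i}) {..<k}; (\<Sum>i<k. b i - a i) < \<delta>\<rbrakk>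
      \<Longrightarrow> (\<Sum>i<k. dist (y (a i)) (y (b i))) < \<epsilon>"
    using assms unfolding absolutely_continuous_on_interval_def by meson
  show thesis
  proof (rule that[OF \<open>\<delta> > 0\<close>])
    fix I :: "'i set" and a b
    assume I: "finite I" "\<And>i. i \<in> I \<Longrightarrow> u \<le> a i \<and> a i \<le> b i \<and> b i \<le> v"
      "disjoint_family_on (\<lambda>i. {a i<..<b i}) I" "(\<Sum>i\<in>I. b i - a i) < \<delta>"
    obtain \<sigma> where \<sigma>: "bij_betw \<sigma> {..<card I} I"
      using \<open>finite I\<close> ex_bij_betw_nat_finite lessThan_atLeast0 by metis
    have "(\<Sum>i<card I. dist (y ((a \<circ> \<sigma>) i)) (y ((b \<circ> \<sigma>) i))) < \<epsilon>"
    proof (rule \<delta>)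
      show "\<forall>i<card I. u \<le> (a \<circ> \<sigma>) i \<and> (a \<circ> \<sigma>) i \<le> (b \<circ> \<sigma>) i \<and> (b \<circ> \<sigma>) i \<le> v"
        using I(2) bij_betwE[OF \<sigma>] by auto
      show "disjoint_family_on (\<lambda>i. {(a \<circ> \<sigma>) i<..<(b \<circ> \<sigma>) i}) {..<card I}"
        using I(3) bij_betwE[OF \<sigma>] bij_betw_imp_inj_on[OF \<sigma>]
        unfolding disjoint_family_on_def inj_on_def comp_def by metis
      show "(\<Sum>i<card I. (b \<circ> \<sigma>) i - (a \<circ> \<sigma>) i) < \<delta>"
        using I(4) sum.reindex_bij_betw[OF \<sigma>, of "\<lambda>i. b i - a i"] by simp
    qed
    then show "(\<Sum>i\<in>I. dist (y (a i)) (y (b i))) < \<epsilon>"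
      using sum.reindex_bij_betw[OF \<sigma>, of "\<lambda>i. dist (y (a i)) (y (b i))"] by simp
  qed
qed

lemma ac_subset:
  assumes "absolutely_continuous_on_interval u v y" "u \<le> u'" "v' \<le> v"
  shows "absolutely_continuous_on_interval u' v' y"
  unfolding absolutely_continuous_on_interval_def
proof (intro allI impI)
  fix \<epsilon> :: real assume "\<epsilon> > 0"
  from ac_on_finite_family[OF assms(1) this] obtain \<delta> where "\<delta> > 0"
    and \<delta>: "\<And>(I :: nat set) a b. \<lbrakk>finite I; \<And>i. i \<in> I \<Longrightarrow> u \<le> a i \<and> a i \<le> b i \<and> b i \<le> v;
       disjoint_family_on (\<lambda>i. {a i<..<b i}) I; (\<Sum>i\<in>I. b i - a i) < \<delta>\<rbrakk>
       \<Longrightarrow> (\<Sum>i\<in>I. dist (y (a i)) (y (b i))) < \<epsilon>" by blast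
  then show "\<exists>\<delta>>0. \<forall>(k::nat) a b. (\<forall>i<k. u' \<le> a i \<and> a i \<le> b i \<and> b i \<le> v') \<longrightarrow>
        disjoint_family_on (\<lambda>i. {a i<..<b i}) {..<k} \<longrightarrow> (\<Sum>i<k. b i - a i) < \<delta> \<longrightarrow>
        (\<Sum>i<k. dist (y (a i)) (y (b i))) < \<epsilon>"
    using assms(2,3)
    by (intro exI[of _ \<delta>]) (auto intro!: \<delta> intro: order_trans)
qed

lemma ac_uniformly_continuous:
  assumes "absolutely_continuous_on_interval u v y"
  shows "uniformly_continuous_on {u..v} y"
  unfolding uniformly_continuous_on_def
proof (intro allI impI)
  fix e :: real assume "e > 0"
  from ac_on_finite_family[OF assms this] obtain \<delta> where "\<delta> > 0"
    and \<delta>: "\<And>(I :: nat set) a b. \<lbrakk>finite I; \<And>i. i \<in> I \<Longrightarrow> u \<le> a i \<and> a i \<le> b i \<and> b i \<le> v;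
       disjoint_family_on (\<lambda>i. {a i<..<b i}) I; (\<Sum>i\<in>I. b i - a i) < \<delta>\<rbrakk>
       \<Longrightarrow> (\<Sum>i\<in>I. dist (y (a i)) (y (b i))) < e" by blast
  have ordered: "dist (y r) (y s) < e"
    if "r \<in> {u..v}" "s \<in> {u..v}" "r \<le> s" "s - r < \<delta>" for r s
    using \<delta>[of "{0}" "\<lambda>_. r" "\<lambda>_. s"] that by (simp add: disjoint_family_on_def)
  have "dist (y r) (y s) < e" if "r \<in> {u..v}" "s \<in> {u..v}" "dist r s < \<delta>" for r s
    using ordered[of r s] ordered[of s r] that
    by (cases r s rule: linorder_le_cases) (simp_all add: dist_real_def dist_commute)
  with \<open>\<delta> > 0\<close> show "\<exists>d>0. \<forall>x\<in>{u..v}. \<forall>x'\<in>{u..v}. dist x' x < d \<longrightarrow> dist (y x') (y x) < e"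
    by blast
qed

text \<open>The Lipschitz condition is placed on the image of \<open>y\<close> alone because the
  maps of interest are polynomials, which are in general not globally Lipschitz.\<close>

lemma ac_lipschitz_compose:
  assumes "L-lipschitz_on (y ` {u..v}) p" "absolutely_continuous_on_interval u v y"
  shows "absolutely_continuous_on_interval u v (\<lambda>s. p (y s))"
  unfolding absolutely_continuous_on_interval_def
proof (intro allI impI)
  have L: "L \<ge> 0" using assms(1) by (rule lipschitz_on_nonneg)
  fix \<epsilon> :: real assume "\<epsilon> > 0"
  \<comment> \<open>\<open>L + 1\<close> instead of \<open>L\<close> keeps the divisor positive when
    \<open>L = 0\<close>.\<close>
  then have "\<epsilon> / (L + 1) > 0" using L by simp
  from ac_on_finite_family[OF assms(2) this] obtain \<delta> where "\<delta> > 0"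
    and \<delta>: "\<And>(I :: nat set) a b. \<lbrakk>finite I; \<And>i. i \<in> I \<Longrightarrow> u \<le> a i \<and> a i \<le> b i \<and> b i \<le> v;
       disjoint_family_on (\<lambda>i. {a i<..<b i}) I; (\<Sum>i\<in>I. b i - a i) < \<delta>\<rbrakk>
       \<Longrightarrow> (\<Sum>i\<in>I. dist (y (a i)) (y (b i))) < \<epsilon> / (L + 1)" by blast
  have "(\<Sum>i<k. dist (p (y (a i))) (p (y (b i)))) < \<epsilon>"
    if "\<forall>i<k. u \<le> a i \<and> a i \<le> b i \<and> b i \<le> v"
      "disjoint_family_on (\<lambda>i. {a i<..<b i}) {..<k}" "(\<Sum>i<k. b i - a i) < \<delta>" for k :: nat and a b
  proof -
    have "(\<Sum>i<k. dist (p (y (a i))) (p (y (b i)))) \<le> (\<Sum>i<k. (L + 1) * dist (y (a i)) (y (b i)))"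
    proof (rule sum_mono)
      fix i assume "i \<in> {..<k}"
      then have "a i \<in> {u..v}" "b i \<in> {u..v}" using that(1) by force+
      then have "dist (p (y (a i))) (p (y (b i))) \<le> L * dist (y (a i)) (y (b i))"
        using lipschitz_onD[OF assms(1)] by simp
      then show "dist (p (y (a i))) (p (y (b i))) \<le> (L + 1) * dist (y (a i)) (y (b i))"
        by (simp add: distrib_right add_increasing2)
    qed
    also have "\<dots> = (L + 1) * (\<Sum>i<k. dist (y (a i)) (y (b i)))"
      by (simp add: sum_distrib_left)
    also have "\<dots> < \<epsilon>"
      using \<delta>[of "{..<k}" a b] that L by (simp add: field_simps)
    finally show ?thesis .
  qed
  with \<open>\<delta> > 0\<close> show "\<exists>\<delta>>0. \<forall>(k::nat) a b. (\<forall>i<k. u \<le> a i \<and> a i \<le> b i \<and> b i \<le> v) \<longrightarrow>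
        disjoint_family_on (\<lambda>i. {a i<..<b i}) {..<k} \<longrightarrow> (\<Sum>i<k. b i - a i) < \<delta> \<longrightarrow>
        (\<Sum>i<k. dist (p (y (a i))) (p (y (b i)))) < \<epsilon>"
    by blast
qed

lemma ac_id: "absolutely_continuous_on_interval u v (\<lambda>s::real. s)"
  unfolding absolutely_continuous_on_interval_def
proof (intro allI impI)
  fix \<epsilon> :: real assume "\<epsilon> > 0"
  have "(\<Sum>i<k. dist (a i) (b i)) = (\<Sum>i<k. b i - a i)"
    if "\<forall>i<k. u \<le> a i \<and> a i \<le> b i \<and> b i \<le> v" for k :: nat and a b
    using that by (intro sum.cong) (auto simp: dist_real_def)
  with \<open>\<epsilon> > 0\<close> show "\<exists>\<delta>>0. \<forall>(k::nat) a b. (\<forall>i<k. u \<le> a i \<and> a i \<le> b i \<and> b i \<le> v) \<longrightarrow>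
        disjoint_family_on (\<lambda>i. {a i<..<b i}) {..<k} \<longrightarrow> (\<Sum>i<k. b i - a i) < \<delta> \<longrightarrow>
        (\<Sum>i<k. dist (a i) (b i)) < \<epsilon>"
    by (intro exI[of _ \<epsilon>]) auto
qed

lemma lipschitz_imp_ac:
  assumes "L-lipschitz_on {u..v} y"
  shows "absolutely_continuous_on_interval u v y"
  using ac_lipschitz_compose[OF _ ac_id, of L u v y] assms by simp

lemma ac_Pair:
  assumes "absolutely_continuous_on_interval u v y" "absolutely_continuous_on_interval u v z"
  shows "absolutely_continuous_on_interval u v (\<lambda>s. (y s, z s))"
  unfolding absolutely_continuous_on_interval_def
proof (intro allI impI)
  fix \<epsilon> :: real assume "\<epsilon> > 0"
  then have e2: "\<epsilon> / 2 > 0" by simp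
  from ac_on_finite_family[OF assms(1) e2] obtain \<delta>1 where "\<delta>1 > 0"
    and \<delta>1: "\<And>(I :: nat set) a b. \<lbrakk>finite I; \<And>i. i \<in> I \<Longrightarrow> u \<le> a i \<and> a i \<le> b i \<and> b i \<le> v;
       disjoint_family_on (\<lambda>i. {a i<..<b i}) I; (\<Sum>i\<in>I. b i - a i) < \<delta>1\<rbrakk>
       \<Longrightarrow> (\<Sum>i\<in>I. dist (y (a i)) (y (b i))) < \<epsilon> / 2" by blast
  from ac_on_finite_family[OF assms(2) e2] obtain \<delta>2 where "\<delta>2 > 0"
    and \<delta>2: "\<And>(I :: nat set) a b. \<lbrakk>finite I; \<And>i. i \<in> I \<Longrightarrow> u \<le> a i \<and> a i \<le> b i \<and> b i \<le> v;
       disjoint_family_on (\<lambda>i. {a i<..<b i}) I; (\<Sum>i\<in>I. b i - a i) < \<delta>2\<rbrakk>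
       \<Longrightarrow> (\<Sum>i\<in>I. dist (z (a i)) (z (b i))) < \<epsilon> / 2" by blast
  have "(\<Sum>i<k. dist (y (a i), z (a i)) (y (b i), z (b i))) < \<epsilon>"
    if "\<forall>i<k. u \<le> a i \<and> a i \<le> b i \<and> b i \<le> v"
      "disjoint_family_on (\<lambda>i. {a i<..<b i}) {..<k}" "(\<Sum>i<k. b i - a i) < min \<delta>1 \<delta>2"
    for k :: nat and a b
  proof -
    have "(\<Sum>i<k. dist (y (a i), z (a i)) (y (b i), z (b i)))
        \<le> (\<Sum>i<k. dist (y (a i)) (y (b i)) + dist (z (a i)) (z (b i)))"
      by (intro sum_mono) (simp add: dist_Pair_Pair sqrt_sum_squares_le_sum)
    also have "\<dots> < \<epsilon>"
      using \<delta>1[of "{..<k}" a b] \<delta>2[of "{..<k}" a b] that by (simp add: sum.distrib)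
    finally show ?thesis .
  qed
  with \<open>\<delta>1 > 0\<close> \<open>\<delta>2 > 0\<close>
  show "\<exists>\<delta>>0. \<forall>(k::nat) a b. (\<forall>i<k. u \<le> a i \<and> a i \<le> b i \<and> b i \<le> v) \<longrightarrow>
        disjoint_family_on (\<lambda>i. {a i<..<b i}) {..<k} \<longrightarrow> (\<Sum>i<k. b i - a i) < \<delta> \<longrightarrow>
        (\<Sum>i<k. dist (y (a i), z (a i)) (y (b i), z (b i))) < \<epsilon>"
    by (intro exI[of _ "min \<delta>1 \<delta>2"]) auto
qed

section \<open>Monotonicity from the sign of an almost everywhere derivative\<close>

text \<open>
  No covering theorem is needed: take a tagged division that is fine for a gauge controlling the
  difference quotients at the good points and lying in a small open neighbourhood of \<open>N\<close> at the
  bad ones. Absolute continuity bounds the contribution of the intervals tagged in \<open>N\<close>.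
\<close>

lemma ac_ae_nonpos_derivative_imp_le:
  fixes \<phi> :: "real \<Rightarrow> real"
  assumes ac: "absolutely_continuous_on_interval a b \<phi>" and "a \<le> b"
    and N: "negligible N"
    and deriv: "\<And>s. s \<in> {a..b} - N \<Longrightarrow>
      \<exists>D\<le>0. (\<phi> has_real_derivative D) (at s within {a..b})"
  shows "\<phi> b \<le> \<phi> a"
proof -
  \<comment> \<open>The term \<open>e * (b - a)\<close> pays for the intervals tagged outside
    \<open>N\<close>, the extra \<open>e\<close> for those tagged in \<open>N\<close>.\<close>
  have bound: "\<phi> b - \<phi> a \<le> e * (b - a) + e" if "e > 0" for e
  proof -
    from ac_on_finite_family[OF ac that] obtain \<delta> where "\<delta> > 0"
      and \<delta>: "\<And>(I :: (real \<times> real set) set) u v. \<lbrakk>finite I; \<And>i. i \<in> I \<Longrightarrow> a \<le> u i \<and> u i \<le> v i \<and> v i \<le> b;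
       disjoint_family_on (\<lambda>i. {u i<..<v i}) I; (\<Sum>i\<in>I. v i - u i) < \<delta>\<rbrakk>
       \<Longrightarrow> (\<Sum>i\<in>I. dist (\<phi> (u i)) (\<phi> (v i))) < e" by blast
    have "N \<in> sets lebesgue" using N by (simp add: negligible_imp_sets)
    then obtain U where U: "open U" "N \<subseteq> U" "U - N \<in> lmeasurable"
      "emeasure lebesgue (U - N) < ennreal \<delta>"
      using sets_lebesgue_outer_open \<open>\<delta> > 0\<close> by blast
    have Um: "U \<in> lmeasurable" and mU: "measure lebesgue U < \<delta>"
    proof -
      have UN: "U = (U - N) \<union> N" using U by blast
      show "U \<in> lmeasurable"
        using U(3) negligible_imp_measurable[OF N] UN by (metis fmeasurable.Un)
      have "measure lebesgue U \<le> measure lebesgue (U - N) + measure lebesgue N"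
        using U(3) negligible_imp_measurable[OF N] UN
        by (metis fmeasurableD measure_Un_le)
      also have "\<dots> < \<delta>"
        using U(3,4) N \<open>\<delta> > 0\<close>
        by (simp add: negligible_imp_measure0 emeasure_eq_measure2 ennreal_less_iff)
      finally show "measure lebesgue U < \<delta>" .
    qed
    \<comment> \<open>Straddle estimate: differentiability at the single point \<open>s\<close>
      controls increments over intervals containing \<open>s\<close>, by adding the estimates for
      the two halves. Tags always lie in their intervals, so this is enough.\<close>
    have "\<exists>d>0. \<forall>u v. a \<le> u \<longrightarrow> u \<le> s \<longrightarrow> s \<le> v \<longrightarrow> v \<le> b \<longrightarrow> s - u < d \<longrightarrow> v - s < d \<longrightarrow>
        \<phi> v - \<phi> u \<le> e * (v - u)" if s: "s \<in> {a..b} - N" for s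
    proof -
      obtain D where "D \<le> 0" and D: "(\<phi> has_real_derivative D) (at s within {a..b})"
        using deriv[OF s] by blast
      then have "(\<phi> has_derivative (\<lambda>h. D * h)) (at s within {a..b})"
        by (simp add: has_field_derivative_def)
      then obtain d where "d > 0" and d: "\<And>y. y \<in> {a..b} \<Longrightarrow> norm (y - s) < d \<Longrightarrow>
          norm (\<phi> y - \<phi> s - D * (y - s)) \<le> e * norm (y - s)"
        using \<open>e > 0\<close> by (meson has_derivative_within_alt)
      have "\<phi> v - \<phi> u \<le> e * (v - u)"
        if "a \<le> u" "u \<le> s" "s \<le> v" "v \<le> b" "s - u < d" "v - s < d" for u v
      proof -
        have "\<phi> v - \<phi> s - D * (v - s) \<le> e * (v - s)"
          using d[of v] that by (simp add: abs_le_iff)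
        moreover have "- (\<phi> u - \<phi> s - D * (u - s)) \<le> e * (s - u)"
          using d[of u] that by (simp add: abs_le_iff)
        ultimately have "\<phi> v - \<phi> u \<le> D * (v - u) + e * (v - u)"
          by (simp add: algebra_simps)
        moreover have "D * (v - u) \<le> 0" using \<open>D \<le> 0\<close> that by (simp add: mult_nonpos_nonneg)
        ultimately show ?thesis by linarith
      qed
      with \<open>d > 0\<close> show ?thesis by blast
    qed
    then obtain d where d0: "\<And>s. s \<in> {a..b} - N \<Longrightarrow> d s > 0"
      and d: "\<And>s u v. \<lbrakk>s \<in> {a..b} - N; a \<le> u; u \<le> s; s \<le> v; v \<le> b; s - u < d s; v - s < d s\<rbrakk>
         \<Longrightarrow> \<phi> v - \<phi> u \<le> e * (v - u)"
      by metis
    \<comment> \<open>Points outside \<open>{a..b}\<close> never occur as tags; the default radius 1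
      makes \<gamma> a gauge there.\<close>
    define \<gamma> where "\<gamma> s = (if s \<in> N then U else if s \<in> {a..b} then ball s (d s) else ball s 1)" for s
    have "gauge \<gamma>"
      using U d0 by (auto simp: gauge_def \<gamma>_def)
    then obtain p where p: "p tagged_division_of {a..b}" "\<gamma> fine p"
      using fine_division_exists_real by blast
    have fin: "finite p" using p(1) by blast
    have K: "\<exists>u v. k = {u..v} \<and> a \<le> u \<and> u \<le> x \<and> x \<le> v \<and> v \<le> b"
      if "(x, k) \<in> p" for x k
    proof -
      obtain u v where "k = cbox u v" using p(1) \<open>(x, k) \<in> p\<close> by blast
      moreover have "x \<in> k" "k \<subseteq> {a..b}" using p(1) \<open>(x, k) \<in> p\<close> by blast+
      ultimately show ?thesis by auto
    qed
    define q where "q = {z \<in> p. fst z \<in> N}"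
    have finq: "finite q" "q \<subseteq> p" using fin by (auto simp: q_def)
    let ?u = "\<lambda>z::real \<times> real set. Inf (snd z)"
    let ?v = "\<lambda>z::real \<times> real set. Sup (snd z)"
    have dis: "disjoint_family_on (\<lambda>z. {?u z<..<?v z}) q"
      unfolding disjoint_family_on_def
    proof (intro ballI impI)
      fix z w assume zw: "z \<in> q" "w \<in> q" "z \<noteq> w"
      then have "interior (snd z) \<inter> interior (snd w) = {}"
        using p(1) finq(2) tagged_division_ofD(5)[OF p(1), of "fst z" "snd z" "fst w" "snd w"]
        by auto
      moreover have "{?u z<..<?v z} = interior (snd z)" "{?u w<..<?v w} = interior (snd w)"
        using zw finq(2) K[of "fst z" "snd z"] K[of "fst w" "snd w"] by force+
      ultimately show "{?u z<..<?v z} \<inter> {?u w<..<?v w} = {}" by simp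
    qed
    have sub: "{?u z<..<?v z} \<subseteq> U" and uv: "a \<le> ?u z \<and> ?u z \<le> ?v z \<and> ?v z \<le> b" if "z \<in> q" for z
    proof -
      have zp: "(fst z, snd z) \<in> p" "fst z \<in> N" using that by (auto simp: q_def)
      then have "snd z \<subseteq> U" using p(2) by (force simp: fine_def \<gamma>_def)
      then show "{?u z<..<?v z} \<subseteq> U" using K[OF zp(1)] by auto
      show "a \<le> ?u z \<and> ?u z \<le> ?v z \<and> ?v z \<le> b" using K[OF zp(1)] by auto
    qed
    have "(\<Sum>z\<in>q. ?v z - ?u z) = (\<Sum>z\<in>q. measure lebesgue {?u z<..<?v z})"
      using uv by (intro sum.cong) auto
    also have "\<dots> = measure lebesgue (\<Union>z\<in>q. {?u z<..<?v z})"
      using finq dis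
      by (intro measure_UNION'[symmetric]) (auto simp: disjoint_family_on_def pairwise_def disjnt_def)
    also have "\<dots> \<le> measure lebesgue U"
      using sub Um finq by (intro measure_mono_fmeasurable) auto
    also have "\<dots> < \<delta>" by (rule mU)
    finally have "(\<Sum>z\<in>q. dist (\<phi> (?u z)) (\<phi> (?v z))) < e"
      using \<delta>[OF finq(1) uv dis] by blast
    moreover have "(\<Sum>z\<in>q. \<phi> (?v z) - \<phi> (?u z)) \<le> (\<Sum>z\<in>q. dist (\<phi> (?u z)) (\<phi> (?v z)))"
      by (intro sum_mono) (simp add: dist_real_def)
    ultimately have q_sum: "(\<Sum>z\<in>q. \<phi> (?v z) - \<phi> (?u z)) \<le> e" by linarith
    have "(\<Sum>z\<in>p-q. \<phi> (?v z) - \<phi> (?u z)) \<le> (\<Sum>z\<in>p-q. e * (?v z - ?u z))"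
    proof (rule sum_mono)
      fix z assume "z \<in> p - q"
      then have z: "(fst z, snd z) \<in> p" "fst z \<notin> N" by (auto simp: q_def)
      obtain u v where k: "snd z = {u..v}" "a \<le> u" "u \<le> fst z" "fst z \<le> v" "v \<le> b"
        using K[OF z(1)] by blast
      then have "{u..v} \<subseteq> ball (fst z) (d (fst z))"
        using p(2) z by (force simp: fine_def \<gamma>_def)
      moreover have "u \<in> {u..v}" "v \<in> {u..v}" using k by auto
      ultimately have "fst z - u < d (fst z)" "v - fst z < d (fst z)"
        unfolding subset_iff mem_ball dist_real_def by force+
      then have "\<phi> v - \<phi> u \<le> e * (v - u)" using k z by (intro d) auto
      moreover have "u \<le> v" using k by simp
      ultimately show "\<phi> (?v z) - \<phi> (?u z) \<le> e * (?v z - ?u z)"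
        using k by simp
    qed
    also have "\<dots> \<le> (\<Sum>z\<in>p. e * (?v z - ?u z))"
      using fin \<open>e > 0\<close> K by (intro sum_mono2) force+
    \<comment> \<open>The lengths telescope: additivity over the division is applied to the identity
      function.\<close>
    also have "\<dots> = e * (b - a)"
      using additive_tagged_division_1[OF \<open>a \<le> b\<close> p(1), of "\<lambda>x. x"]
      by (simp add: case_prod_unfold flip: sum_distrib_left)
    finally have "(\<Sum>z\<in>p-q. \<phi> (?v z) - \<phi> (?u z)) \<le> e * (b - a)" .
    moreover have "\<phi> b - \<phi> a = (\<Sum>z\<in>p. \<phi> (?v z) - \<phi> (?u z))"
      using additive_tagged_division_1[OF \<open>a \<le> b\<close> p(1), of \<phi>] by (simp add: case_prod_unfold)
    moreover have "\<dots> = (\<Sum>z\<in>p-q. \<phi> (?v z) - \<phi> (?u z)) + (\<Sum>z\<in>q. \<phi> (?v z) - \<phi> (?u z))"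
      by (rule sum.subset_diff[OF finq(2) fin])
    ultimately show ?thesis using q_sum by linarith
  qed
  have "\<phi> b - \<phi> a \<le> 0"
  proof (rule field_le_epsilon)
    fix e :: real assume "e > 0"
    \<comment> \<open>Here \<open>c\<close> stands for \<open>b - a + 1\<close>, which is positive
      even if \<open>a = b\<close>; with \<open>e / c\<close> in place of \<open>e\<close> the bound
      adds up to \<open>e\<close>.\<close>
    have "e / c * (c - 1) + e / c = e" if "c \<noteq> 0" for c
      using that by (simp add: field_simps)
    from this[of "b - a + 1"] have "e / (b - a + 1) * (b - a) + e / (b - a + 1) = e"
      using \<open>a \<le> b\<close> by (simp add: add.commute)
    then show "\<phi> b - \<phi> a \<le> 0 + e"
      using bound[of "e / (b - a + 1)"] \<open>e > 0\<close> \<open>a \<le> b\<close> by simp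
  qed
  then show ?thesis by simp
qed

section \<open>Lipschitz bounds for polynomials on bounded sets\<close>

text \<open>On a bounded set Lipschitz functions are bounded, and inserting the mixed term
  \<open>f x * g y\<close> gives the constant \<open>M * B + N * A\<close>.\<close>

lemma lipschitz_on_mult_bounded:
  fixes f g :: "'a::euclidean_space \<Rightarrow> real"
  assumes "bounded S" "A-lipschitz_on S f" "B-lipschitz_on S g"
  shows "\<exists>L. L-lipschitz_on S (\<lambda>x. f x * g x)"
proof -
  have AB: "A \<ge> 0" "B \<ge> 0" using assms lipschitz_on_nonneg by blast+
  have "bounded (f ` S)" "bounded (g ` S)"
    using assms by (auto intro!: bounded_uniformly_continuous_image lipschitz_on_uniformly_continuous)
  then obtain M N where M: "\<And>x. x \<in> S \<Longrightarrow> \<bar>f x\<bar> \<le> M" "M > 0" and N: "\<And>x. x \<in> S \<Longrightarrow> \<bar>g x\<bar> \<le> N" "N > 0"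
    unfolding bounded_pos by auto
  have "(M * B + N * A)-lipschitz_on S (\<lambda>x. f x * g x)"
  proof (rule lipschitz_onI)
    fix x y assume xy: "x \<in> S" "y \<in> S"
    have "f x * g x - f y * g y = f x * (g x - g y) + g y * (f x - f y)"
      by (simp add: algebra_simps)
    then have "\<bar>f x * g x - f y * g y\<bar> \<le> \<bar>f x\<bar> * \<bar>g x - g y\<bar> + \<bar>g y\<bar> * \<bar>f x - f y\<bar>"
      by (metis abs_mult abs_triangle_ineq)
    also have "\<dots> \<le> M * (B * dist x y) + N * (A * dist x y)"
      using lipschitz_onD[OF assms(2) xy] lipschitz_onD[OF assms(3) xy] M N xy
      by (intro add_mono mult_mono) (auto simp: dist_real_def)
    finally show "dist (f x * g x) (f y * g y) \<le> (M * B + N * A) * dist x y"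
      by (simp add: dist_real_def algebra_simps)
  qed (use M N AB in auto)
  then show ?thesis by blast
qed

text \<open>Induction over the construction of the polynomial works on every bounded set, including
  the graph of a trajectory, where a mean value argument would first need a convex set.\<close>

lemma real_polynomial_function_lipschitz_on:
  fixes p :: "'a::euclidean_space \<Rightarrow> real"
  assumes "real_polynomial_function p" "bounded S"
  shows "\<exists>L. L-lipschitz_on S p"
  using assms(1)
proof induction
  case (linear f)
  then show ?case by (meson bounded_linear.lipschitz_boundE)
next
  case (const c)
  then show ?case using lipschitz_on_constant by blast
next
  case (add f g)
  then show ?case using lipschitz_on_add by blast
next
  case (mult f g)
  then show ?case using lipschitz_on_mult_bounded[OF assms(2)] by blast
qed

lemma polynomial_components_lipschitz_on:
  fixes f :: "'a::euclidean_space \<Rightarrow> real ^ 'n"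
  assumes "\<And>i. real_polynomial_function (\<lambda>z. f z $ i)" "bounded S"
  shows "\<exists>L. L-lipschitz_on S f"
proof -
  obtain L where L: "\<And>i. (L i)-lipschitz_on S (\<lambda>z. f z $ i)"
    using real_polynomial_function_lipschitz_on[OF assms] by metis
  have "(\<Sum>i\<in>UNIV. L i)-lipschitz_on S f"
  proof (rule lipschitz_onI)
    fix x y assume xy: "x \<in> S" "y \<in> S"
    have "dist (f x) (f y) \<le> (\<Sum>i\<in>UNIV. \<bar>(f x - f y) $ i\<bar>)"
      unfolding dist_norm by (rule norm_le_l1_cart)
    also have "\<dots> \<le> (\<Sum>i\<in>UNIV. L i * dist x y)"
      using lipschitz_onD[OF L xy] by (intro sum_mono) (simp add: dist_real_def)
    finally show "dist (f x) (f y) \<le> (\<Sum>i\<in>UNIV. L i) * dist x y"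
      by (simp add: sum_distrib_right)
  qed (use L lipschitz_on_nonneg in \<open>blast intro: sum_nonneg\<close>)
  then show ?thesis by blast
qed

section \<open>Indefinite integrals of bounded measurable functions\<close>

lemma bounded_measurable_integrable_on:
  fixes F :: "real \<Rightarrow> 'a::euclidean_space"
  assumes "F \<in> borel_measurable (lebesgue_on {a..b})" "\<And>s. s \<in> {a..b} \<Longrightarrow> norm (F s) \<le> M"
    and "{u..v} \<subseteq> {a..b}"
  shows "F integrable_on {u..v}"
proof -
  have "F integrable_on {a..b}"
    using assms(1) integrable_const_ivl[of M a b] assms(2)
    by (rule measurable_bounded_by_integrable_imp_integrable) auto
  then show ?thesis
    using assms(3) by (rule integrable_on_subinterval)
qed

lemma indefinite_integral_diff:
  fixes F :: "real \<Rightarrow> 'a::euclidean_space"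
  assumes "F integrable_on {a..v}" "a \<le> u" "u \<le> v"
  shows "integral {a..v} F - integral {a..u} F = integral {u..v} F"
  using Henstock_Kurzweil_Integration.integral_combine[OF assms(2,3,1)]
  by (simp add: algebra_simps)

lemma indefinite_integral_lipschitz:
  fixes F :: "real \<Rightarrow> 'a::euclidean_space"
  assumes F: "F \<in> borel_measurable (lebesgue_on {0..T})"
    and M: "\<And>s. s \<in> {0..T} \<Longrightarrow> norm (F s) \<le> M" and "M \<ge> 0"
  shows "M-lipschitz_on {0..T} (\<lambda>t. x0 + integral {0..t} F)"
proof (rule lipschitz_on_leI)
  fix u v :: real assume uv: "u \<in> {0..T}" "v \<in> {0..T}" "u \<le> v"
  have "dist (x0 + integral {0..u} F) (x0 + integral {0..v} F) = norm (integral {0..v} F - integral {0..u} F)"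
    by (simp add: dist_norm norm_minus_commute)
  also have "\<dots> = norm (integral {u..v} F)"
    using uv indefinite_integral_diff[of F 0 v u] bounded_measurable_integrable_on[OF F M, of 0 v] by simp
  also have "\<dots> \<le> integral {u..v} (\<lambda>_. M)"
    using uv M
    by (intro Henstock_Kurzweil_Integration.integral_norm_bound_integral
          bounded_measurable_integrable_on[OF F M]) auto
  also have "\<dots> = M * dist u v" using uv by (simp add: dist_real_def)
  finally show "dist (x0 + integral {0..u} F) (x0 + integral {0..v} F) \<le> M * dist u v" .
qed (use \<open>M \<ge> 0\<close> in simp)

text \<open>Lebesgue's differentiation theorem; it turns a solution of the integral equation into an
  almost everywhere solution of the differential equation.\<close>

lemma indefinite_integral_has_vector_derivative_ae:
  fixes F :: "real \<Rightarrow> 'a::euclidean_space"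
  assumes F: "F \<in> borel_measurable (lebesgue_on {0..T})"
    and M: "\<And>s. s \<in> {0..T} \<Longrightarrow> norm (F s) \<le> M"
  obtains N where "negligible N"
    "\<And>t. t \<in> {0..T} - N \<Longrightarrow>
       ((\<lambda>t. x0 + integral {0..t} F) has_vector_derivative F t) (at t within {0..T})"
proof -
  have int: "F integrable_on {u..v}" if "{u..v} \<subseteq> {0..T}" for u v
    using bounded_measurable_integrable_on[OF F M that] .
  \<comment> \<open>Extension by zero, because increments to the right of \<open>T\<close>, and to
    the left of 0 after reflection, leave the interval.\<close>
  define G where "G s = (if s \<in> {0..T} then F s else 0)" for s
  have "G integrable_on UNIV"
    using int[of 0 T] unfolding G_def by (simp only: integrable_restrict_UNIV)
  then have G: "G integrable_on {u..v}" for u v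
    by (rule integrable_on_subinterval) auto
  have G': "(\<lambda>s. G (- s)) integrable_on {u..v}" for u v
    using Henstock_Kurzweil_Integration.integrable_reflect_real[of G "- u" "- v"] G by simp
  \<comment> \<open>The library result concerns only increments to the right; reflection supplies the left.\<close>
  obtain N1 where N1: "negligible N1" and right: "\<And>x e. \<lbrakk>x \<notin> N1; 0 < e\<rbrakk> \<Longrightarrow>
      \<exists>d>0. \<forall>h. 0 < h \<and> h < d \<longrightarrow> norm (integral {x..x + h} G /\<^sub>R h - G x) < e"
    using integrable_ccontinuous_explicit[of G] G by auto
  obtain N2 where N2: "negligible N2" and left: "\<And>x e. \<lbrakk>x \<notin> N2; 0 < e\<rbrakk> \<Longrightarrow>
      \<exists>d>0. \<forall>h. 0 < h \<and> h < d \<longrightarrow> norm (integral {x..x + h} (\<lambda>s. G (- s)) /\<^sub>R h - G (- x)) < e"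
    using integrable_ccontinuous_explicit[of "\<lambda>s. G (- s)"] G' by auto
  have "negligible (uminus ` N2)"
    by (rule negligible_differentiable_image_negligible[OF order_refl N2])
      (simp add: differentiable_on_def differentiable_minus)
  with N1 have "negligible (N1 \<union> uminus ` N2)" by (rule negligible_Un)
  moreover have "((\<lambda>t. x0 + integral {0..t} F) has_vector_derivative F t) (at t within {0..T})"
    if t: "t \<in> {0..T} - (N1 \<union> uminus ` N2)" for t
    unfolding has_vector_derivative_def has_derivative_within_alt
  proof (intro conjI allI impI)
    show "bounded_linear (\<lambda>h. h *\<^sub>R F t)" by (rule bounded_linear_scaleR_left)
    fix e :: real assume "e > 0"
    have "t \<notin> N1" "- t \<notin> N2" using t by force+
    obtain d1 where "d1 > 0"
      and d1: "\<And>h. 0 < h \<Longrightarrow> h < d1 \<Longrightarrow> norm (integral {t..t + h} G /\<^sub>R h - G t) < e"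
      using right[OF \<open>t \<notin> N1\<close> \<open>e > 0\<close>] by blast
    obtain d2 where "d2 > 0"
      and d2: "\<And>h. 0 < h \<Longrightarrow> h < d2 \<Longrightarrow>
        norm (integral {- t..- t + h} (\<lambda>s. G (- s)) /\<^sub>R h - G t) < e"
      using left[OF \<open>- t \<notin> N2\<close> \<open>e > 0\<close>] by auto
    \<comment> \<open>Passes from difference quotients to the linear error bound in the definition
      of the derivative.\<close>
    have scale: "norm (I - h *\<^sub>R F t) \<le> e * h" if "norm (I /\<^sub>R h - F t) < e" "h > 0" for I h
    proof -
      have "I - h *\<^sub>R F t = h *\<^sub>R (I /\<^sub>R h - F t)" using that by (simp add: algebra_simps)
      then have "norm (I - h *\<^sub>R F t) = h * norm (I /\<^sub>R h - F t)" using that by simp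
      then show ?thesis using that by (simp add: mult.commute)
    qed
    have GF: "integral {u..v} G = integral {u..v} F" if "u \<in> {0..T}" "v \<in> {0..T}" for u v
      using that by (intro Henstock_Kurzweil_Integration.integral_cong) (auto simp: G_def)
    have Gt: "G t = F t" using t by (simp add: G_def)
    have "norm (x0 + integral {0..s} F - (x0 + integral {0..t} F) - (s - t) *\<^sub>R F t) \<le> e * norm (s - t)"
      if s: "s \<in> {0..T}" "norm (s - t) < min d1 d2" for s
    proof (cases s t rule: linorder_cases)
      case less
      \<comment> \<open>A right increment of the reflected function at \<open>- t\<close> is a left
        increment of the original at \<open>t\<close>.\<close>
      have "integral {- t..- t + (t - s)} (\<lambda>s. G (- s)) = integral {s..t} F"
        using GF[of s t] s t by simp
      then have "norm (integral {s..t} F - (t - s) *\<^sub>R F t) \<le> e * (t - s)"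
        using d2[of "t - s"] s less Gt by (intro scale) auto
      moreover have "integral {0..t} F - integral {0..s} F = integral {s..t} F"
        using less s t by (intro indefinite_integral_diff int) auto
      then have "x0 + integral {0..s} F - (x0 + integral {0..t} F) - (s - t) *\<^sub>R F t
          = - (integral {s..t} F - (t - s) *\<^sub>R F t)"
        by (simp add: algebra_simps)
      ultimately show ?thesis using less by (simp only: norm_minus_cancel) simp
    next
      case equal
      then show ?thesis by simp
    next
      case greater
      have "integral {t..t + (s - t)} G = integral {t..s} F"
        using GF[of t s] s t by simp
      then have "norm (integral {t..s} F - (s - t) *\<^sub>R F t) \<le> e * (s - t)"
        using d1[of "s - t"] s greater Gt by (intro scale) auto
      moreover have "integral {0..s} F - integral {0..t} F = integral {t..s} F"
        using greater s t by (intro indefinite_integral_diff int) auto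
      ultimately show ?thesis using greater by simp
    qed
    then show "\<exists>d>0. \<forall>y\<in>{0..T}. norm (y - t) < d \<longrightarrow>
        norm (x0 + integral {0..y} F - (x0 + integral {0..t} F) - (y - t) *\<^sub>R F t) \<le> e * norm (y - t)"
      using \<open>d1 > 0\<close> \<open>d2 > 0\<close> by (intro exI[of _ "min d1 d2"]) auto
  qed
  ultimately show thesis by (rule that)
qed

section \<open>Caratheodory existence by a weighted contraction\<close>

lemma integral_exp_real:
  fixes K c :: real
  assumes "K > 0" "0 \<le> c"
  shows "((\<lambda>s. exp (K * s)) has_integral (exp (K * c) - 1) / K) {0..c}"
proof -
  have "((\<lambda>s. exp (K * s)) has_integral exp (K * c) / K - exp (K * 0) / K) {0..c}"
    using assms
    by (intro fundamental_theorem_of_calculus)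
      (auto intro!: derivative_eq_intros simp: has_real_derivative_iff_has_vector_derivative[symmetric])
  then show ?thesis by (simp add: diff_divide_distrib)
qed

text \<open>
  Writing the unknown as \<open>exp (K * t) *\<^sub>R z t\<close> turns the integral operator into
  a contraction on all of \<open>{0..T}\<close> at once, so that no local solutions have to be glued.
\<close>

lemma caratheodory_solution_exists:
  fixes F :: "real \<Rightarrow> 'a::euclidean_space \<Rightarrow> 'a"
  assumes "T \<ge> 0"
    and lip: "\<And>s. s \<in> {0..T} \<Longrightarrow> L-lipschitz_on UNIV (F s)"
    and bound: "\<And>s x. s \<in> {0..T} \<Longrightarrow> norm (F s x) \<le> M"
    and meas: "\<And>y. continuous_on UNIV y \<Longrightarrow> (\<lambda>s. F s (y s)) \<in> borel_measurable (lebesgue_on {0..T})"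
  obtains y where "continuous_on UNIV y"
    "\<And>t. t \<in> {0..T} \<Longrightarrow> y t = x0 + integral {0..t} (\<lambda>s. F s (y s))"
proof -
  have L: "L \<ge> 0" using lipschitz_on_nonneg[OF lip[of 0]] \<open>T \<ge> 0\<close> by simp
  have M: "M \<ge> 0" using order_trans[OF norm_ge_zero bound[of 0 0]] \<open>T \<ge> 0\<close> by simp
  \<comment> \<open>The contraction constant will be \<open>L / K\<close>; this \<open>K\<close>
    makes it at most 1/2 and stays positive when \<open>L = 0\<close>.\<close>
  define K where "K = 2 * L + 1"
  have K: "K > 0" "L / K \<le> 1 / 2" using L by (auto simp: K_def field_simps)
  \<comment> \<open>Clamping time to \<open>{0..T}\<close> extends functions on the interval to
    bounded continuous functions on the whole line, as the complete space \<open>bcontfun\<close>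
    requires.\<close>
  define c where "c t = max 0 (min T t)" for t :: real
  have c: "c t \<in> {0..T}" for t using \<open>T \<ge> 0\<close> by (auto simp: c_def)
  have cT: "c t = t" if "t \<in> {0..T}" for t using that by (auto simp: c_def)
  have c_cont: "continuous_on UNIV c" unfolding c_def by (intro continuous_intros)
  define H where "H z s = F s (exp (K * s) *\<^sub>R apply_bcontfun z s)" for z s
  have H_meas: "H z \<in> borel_measurable (lebesgue_on {0..T})" for z
    unfolding H_def by (intro meas continuous_intros) auto
  have H_bound: "norm (H z s) \<le> M" if "s \<in> {0..T}" for z s
    unfolding H_def using bound that by blast
  have H_int: "H z integrable_on {0..c t}" for z t
    using c[of t] by (intro bounded_measurable_integrable_on[OF H_meas H_bound]) auto
  define I where "I z t = x0 + integral {0..t} (H z)" for z t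
  have I_lip: "M-lipschitz_on {0..T} (I z)" for z
    unfolding I_def using indefinite_integral_lipschitz[OF H_meas H_bound M] by blast
  have I_cont: "continuous_on UNIV (\<lambda>t. I z (c t))" for z
    using continuous_on_compose2[OF lipschitz_on_continuous_on[OF I_lip] c_cont] c by blast
  \<comment> \<open>The integral operator in the rescaled unknown: \<open>H\<close> multiplies by
    the exponential weight before integrating, and \<open>P\<close> divides it out again.\<close>
  define P where "P z t = exp (- (K * c t)) *\<^sub>R I z (c t)" for z t
  have P_bcont: "P z \<in> bcontfun" for z
  proof (rule bcontfun_normI)
    show "continuous_on UNIV (P z)"
      unfolding P_def by (intro continuous_intros I_cont c_cont)
    fix t
    have "norm (P z t) \<le> 1 * norm (I z (c t))"
      unfolding P_def norm_scaleR using K c[of t] by (intro mult_right_mono) auto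
    also have "norm (I z (c t)) \<le> norm (I z 0) + dist (I z (c t)) (I z 0)"
      unfolding dist_norm by (rule norm_triangle_sub)
    also have "dist (I z (c t)) (I z 0) \<le> M * dist (c t) 0"
      using lipschitz_onD[OF I_lip c, of 0] \<open>T \<ge> 0\<close> by auto
    also have "\<dots> \<le> M * T"
      using M c[of t] by (intro mult_left_mono) (auto simp: dist_real_def)
    finally show "norm (P z t) \<le> norm x0 + M * T" by (simp add: I_def)
  qed
  \<comment> \<open>The integrands differ by at most \<open>L * dist z w * exp (K * s)\<close>.
    Integration gains a factor \<open>1 / K\<close>, and the outer weight cancels the growth of the
    exponential, uniformly in \<open>t\<close>.\<close>
  have "dist (Bcontfun (P z)) (Bcontfun (P w)) \<le> 1 / 2 * dist z w" for z w
  proof (rule dist_bound)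
    fix t
    have cc: "0 \<le> c t" "c t \<le> T" using c[of t] by auto
    have "dist (P z t) (P w t) = exp (- (K * c t)) * norm (I z (c t) - I w (c t))"
      unfolding P_def dist_norm by (simp flip: scaleR_diff_right)
    also have "I z (c t) - I w (c t) = integral {0..c t} (\<lambda>s. H z s - H w s)"
      unfolding I_def by (simp add: H_int Henstock_Kurzweil_Integration.integral_diff)
    also have "norm (integral {0..c t} (\<lambda>s. H z s - H w s))
        \<le> integral {0..c t} (\<lambda>s. L * dist z w * exp (K * s))"
    proof (rule Henstock_Kurzweil_Integration.integral_norm_bound_integral)
      show "(\<lambda>s. H z s - H w s) integrable_on {0..c t}"
        by (intro Henstock_Kurzweil_Integration.integrable_diff H_int)
      show "(\<lambda>s. L * dist z w * exp (K * s)) integrable_on {0..c t}"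
        by (intro integrable_continuous_real continuous_intros)
      fix s assume s: "s \<in> {0..c t}"
      have "norm (H z s - H w s) \<le> L * dist (exp (K * s) *\<^sub>R apply_bcontfun z s) (exp (K * s) *\<^sub>R apply_bcontfun w s)"
        unfolding H_def using lipschitz_onD[OF lip[of s]] s cc by (simp add: dist_norm)
      also have "\<dots> = L * (exp (K * s) * dist (apply_bcontfun z s) (apply_bcontfun w s))"
        by (simp add: dist_norm flip: scaleR_diff_right)
      also have "\<dots> \<le> L * (exp (K * s) * dist z w)"
        using L dist_bounded[of z s w] by (intro mult_left_mono) auto
      finally show "norm (H z s - H w s) \<le> L * dist z w * exp (K * s)"
        by (simp add: ac_simps)
    qed
    also have "integral {0..c t} (\<lambda>s. L * dist z w * exp (K * s)) = L * dist z w * ((exp (K * c t) - 1) / K)"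
      using integral_exp_real[OF K(1) cc(1)] by (simp add: integral_unique)
    also have "exp (- (K * c t)) * (L * dist z w * ((exp (K * c t) - 1) / K))
        = L / K * dist z w * (exp (- (K * c t)) * exp (K * c t) - exp (- (K * c t)))"
      by (simp add: algebra_simps diff_divide_distrib)
    also have "\<dots> = L / K * dist z w * (1 - exp (- (K * c t)))"
      by (simp flip: exp_add)
    also have "\<dots> \<le> L / K * dist z w * 1"
      using L K by (intro mult_left_mono) auto
    also have "\<dots> \<le> 1 / 2 * dist z w"
      using mult_right_mono[OF K(2) zero_le_dist[of z w]] by simp
    finally show "dist (apply_bcontfun (Bcontfun (P z)) t) (apply_bcontfun (Bcontfun (P w)) t) \<le> 1 / 2 * dist z w"
      using P_bcont by (simp add: Bcontfun_inverse)
  qed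
  then obtain z where z: "Bcontfun (P z) = z"
    using banach_fix_type[of "1/2" "\<lambda>z. Bcontfun (P z)"] by auto
  have zP: "apply_bcontfun z t = P z t" for t
    using z P_bcont[of z] by (metis Bcontfun_inverse)
  show thesis
  proof (rule that[of "\<lambda>t. exp (K * t) *\<^sub>R apply_bcontfun z t"])
    show "continuous_on UNIV (\<lambda>t. exp (K * t) *\<^sub>R apply_bcontfun z t)"
      by (intro continuous_intros) auto
    show "exp (K * t) *\<^sub>R apply_bcontfun z t =
        x0 + integral {0..t} (\<lambda>s. F s (exp (K * s) *\<^sub>R apply_bcontfun z s))" if "t \<in> {0..T}" for t
    proof -
      have "exp (K * t) *\<^sub>R apply_bcontfun z t = (exp (K * t) * exp (- (K * t))) *\<^sub>R I z t"
        using zP[of t] cT[OF that] by (simp add: P_def)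
      also have "\<dots> = I z t" by (simp flip: exp_add)
      finally show ?thesis by (simp add: I_def H_def[abs_def])
    qed
  qed
qed

section \<open>Explicit null sets, and the exit-time argument\<close>

lemma AE_lebesgue_on_iff_negligible:
  fixes S :: "'a::euclidean_space set"
  assumes "S \<in> sets lebesgue"
  shows "(AE s in lebesgue_on S. P s) \<longleftrightarrow> (\<exists>N. negligible N \<and> (\<forall>s\<in>S - N. P s))"
proof -
  have "(AE s in lebesgue_on S. P s) \<longleftrightarrow> (AE s in lebesgue. s \<in> S \<longrightarrow> P s)"
    using assms by (intro AE_restrict_space_iff) auto
  also have "\<dots> \<longleftrightarrow> (\<exists>N. negligible N \<and> (\<forall>s\<in>S - N. P s))"
  proof
    assume "AE s in lebesgue. s \<in> S \<longrightarrow> P s"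
    then obtain N where "{s. \<not> (s \<in> S \<longrightarrow> P s)} \<subseteq> N" "N \<in> null_sets lebesgue"
      unfolding eventually_ae_filter by auto
    then show "\<exists>N. negligible N \<and> (\<forall>s\<in>S - N. P s)"
      unfolding negligible_iff_null_sets by (intro exI[of _ N]) auto
  next
    assume "\<exists>N. negligible N \<and> (\<forall>s\<in>S - N. P s)"
    then obtain N where "N \<in> null_sets lebesgue" "\<forall>s\<in>S - N. P s"
      unfolding negligible_iff_null_sets by blast
    then show "AE s in lebesgue. s \<in> S \<longrightarrow> P s"
      by (intro AE_I'[of N]) auto
  qed
  finally show ?thesis .
qed

text \<open>At the infimum \<tau> of the exit times, closedness still gives
  \<open>y \<tau> \<in> B\<close>; then \<open>step\<close> improves this to the interior, so by
  continuity no exit can follow closely, contradicting the infimum.\<close>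

lemma continuous_stays_in_closed:
  fixes y :: "real \<Rightarrow> 'a::metric_space"
  assumes cont: "continuous_on {0..T} y" and "closed B" and "y 0 \<in> B"
    and step: "\<And>t. t \<in> {0..T} \<Longrightarrow> (\<And>s. s \<in> {0..t} \<Longrightarrow> y s \<in> B) \<Longrightarrow> y t \<in> interior B"
    and t: "t \<in> {0..T}"
  shows "y t \<in> B"
proof (rule ccontr)
  assume "y t \<notin> B"
  define S where "S = {s \<in> {0..T}. y s \<notin> B}"
  have S: "S \<noteq> {}" "bdd_below S"
    using t \<open>y t \<notin> B\<close> by (auto simp: S_def intro: bdd_belowI[of _ 0])
  define \<tau> where "\<tau> = Inf S"
  have "0 \<le> \<tau>" "\<tau> \<le> t"
    unfolding \<tau>_def
    using cInf_greatest[OF S(1), of 0] cInf_lower[OF _ S(2), of t] t \<open>y t \<notin> B\<close>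
    by (auto simp: S_def)
  then have \<tau>: "\<tau> \<in> {0..T}" using t by auto
  have before: "y s \<in> B" if "0 \<le> s" "s < \<tau>" for s
  proof (rule ccontr)
    assume "y s \<notin> B"
    then have "s \<in> S" using that \<tau> by (simp add: S_def)
    then have "\<tau> \<le> s" unfolding \<tau>_def using S(2) by (rule cInf_lower)
    with that show False by simp
  qed
  have near: "\<exists>d>0. \<forall>s\<in>{0..T}. dist s \<tau> < d \<longrightarrow> y s \<in> U" if U: "open U" "y \<tau> \<in> U" for U
  proof -
    obtain e where "e > 0" and e: "ball (y \<tau>) e \<subseteq> U" using openE[OF U] by blast
    obtain d where "d > 0" and d: "\<And>s. s \<in> {0..T} \<Longrightarrow> dist s \<tau> < d \<Longrightarrow> dist (y s) (y \<tau>) < e"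
      using cont[unfolded continuous_on_iff, rule_format, OF \<tau> \<open>e > 0\<close>] by metis
    have "y s \<in> U" if "s \<in> {0..T}" "dist s \<tau> < d" for s
      using d[OF that] e by (auto simp: dist_commute)
    with \<open>d > 0\<close> show ?thesis by blast
  qed
  have "y \<tau> \<in> B"
  proof (rule ccontr)
    assume "y \<tau> \<notin> B"
    then obtain d where "d > 0" and d: "\<forall>s\<in>{0..T}. dist s \<tau> < d \<longrightarrow> y s \<in> - B"
      using near[of "- B"] \<open>closed B\<close> by (auto simp: open_Compl)
    have "\<tau> > 0" using \<open>0 \<le> \<tau>\<close> \<open>y 0 \<in> B\<close> \<open>y \<tau> \<notin> B\<close> by (cases "\<tau> = 0") auto
    \<comment> \<open>A time before \<tau> so close that \<open>y s\<close> is still outside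
      \<open>B\<close>; the maximum keeps it in the interval, and \<open>\<tau> > 0\<close> keeps it
      strictly earlier.\<close>
    define s where "s = max 0 (\<tau> - d / 2)"
    have "0 \<le> s" "s < \<tau>" "dist s \<tau> < d" using \<open>\<tau> > 0\<close> \<open>d > 0\<close> by (auto simp: s_def dist_real_def)
    then show False using before[of s] d \<tau> by auto
  qed
  with before have "\<And>s. s \<in> {0..\<tau>} \<Longrightarrow> y s \<in> B" by force
  then have "y \<tau> \<in> interior B" by (rule step[OF \<tau>])
  then obtain d where "d > 0" and d: "\<forall>s\<in>{0..T}. dist s \<tau> < d \<longrightarrow> y s \<in> interior B"
    using near[of "interior B"] by auto
  have "\<exists>s\<in>S. s < \<tau> + d"
    using S \<open>d > 0\<close> by (intro cInf_lessD) (auto simp: \<tau>_def)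
  then obtain s where s: "s \<in> S" "s < \<tau> + d" by blast
  moreover have "\<tau> \<le> s" using s S unfolding \<tau>_def by (intro cInf_lower)
  ultimately show False
    using d interior_subset by (force simp: S_def dist_real_def)
qed

section \<open>Differentiating \<psi> along a trajectory\<close>

text \<open>Links the total derivative, which the chain rule needs, to \<open>partial_t\<close> and
  \<open>grad_x\<close>, which are defined by derivatives along coordinate lines.\<close>

lemma has_derivative_along_line:
  assumes "(\<psi> has_derivative D) (at (a::'a::real_normed_vector))"
  shows "((\<lambda>u::real. \<psi> (a + u *\<^sub>R v) :: real) has_real_derivative D v) (at 0)"
proof -
  have "((\<lambda>u::real. a + u *\<^sub>R v) has_derivative (\<lambda>u. u *\<^sub>R v)) (at 0)"
    by (auto intro!: derivative_eq_intros)
  then have "((\<lambda>u::real. \<psi> (a + u *\<^sub>R v)) has_derivative (\<lambda>u. D (u *\<^sub>R v))) (at 0)"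
    by (rule has_derivative_compose) (use assms in simp)
  moreover have "(\<lambda>u. D (u *\<^sub>R v)) = (*) (D v)"
    by (simp add: fun_eq_iff linear_cmul[OF has_derivative_linear[OF assms]])
  ultimately show ?thesis by (simp add: has_field_derivative_def)
qed

lemma partial_t_eq:
  assumes "(\<psi> has_derivative D) (at (x, t))"
  shows "partial_t \<psi> x t = D (0, 1)"
proof -
  have "((\<lambda>u. \<psi> (x, t + u)) has_real_derivative D (0, 1)) (at 0)"
    using has_derivative_along_line[OF assms, of "(0, 1)"] by simp
  then have "((\<lambda>\<tau>. \<psi> (x, \<tau>)) has_real_derivative D (0, 1)) (at t)"
    using DERIV_shift[of "\<lambda>\<tau>. \<psi> (x, \<tau>)" "D (0, 1)" 0 t] by (simp add: add.commute)
  then show ?thesis unfolding partial_t_def by (rule DERIV_imp_deriv)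
qed

lemma grad_x_inner_eq:
  fixes v :: "real ^ 'n"
  assumes D: "(\<psi> has_derivative D) (at (x, t))"
  shows "grad_x \<psi> x t \<bullet> v = D (v, 0)"
proof -
  interpret D: linear D using D by (rule has_derivative_linear)
  have comp: "grad_x \<psi> x t $ i = D (axis i 1, 0)" for i
    using DERIV_imp_deriv[OF has_derivative_along_line[OF D, of "(axis i 1, 0)"]]
    by (simp add: grad_x_def)
  have "(v, 0) = (\<Sum>i\<in>UNIV. v $ i *\<^sub>R (axis i 1 :: real ^ 'n, 0 :: real))"
    using basis_expansion[of v] by (simp add: prod_eq_iff fst_sum snd_sum scalar_mult_eq_scaleR)
  then have "D (v, 0) = (\<Sum>i\<in>UNIV. v $ i * D (axis i 1, 0))"
    by (simp only: D.sum D.scale real_scaleR_def)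
  then show ?thesis by (simp add: inner_vec_def comp mult.commute)
qed

lemma real_polynomial_derivative_along_curve:
  fixes \<psi> :: "(real ^ 'n) \<times> real \<Rightarrow> real"
  assumes "real_polynomial_function \<psi>" and y: "(y has_vector_derivative v) (at s within S)"
  shows "((\<lambda>\<tau>. \<psi> (y \<tau>, \<tau>)) has_real_derivative
      partial_t \<psi> (y s) s + grad_x \<psi> (y s) s \<bullet> v) (at s within S)"
proof -
  obtain D where D: "(\<psi> has_derivative D) (at (y s, s))"
    using differentiable_at_real_polynomial_function[OF assms(1), of "(y s, s)" UNIV]
    unfolding differentiable_def by blast
  interpret D: linear D using D by (rule has_derivative_linear)
  have "((\<lambda>\<tau>. (y \<tau>, \<tau>)) has_derivative (\<lambda>h. (h *\<^sub>R v, h))) (at s within S)"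
    using y unfolding has_vector_derivative_def
    by (intro has_derivative_Pair has_derivative_ident)
  then have "((\<lambda>\<tau>. \<psi> (y \<tau>, \<tau>)) has_derivative (\<lambda>h. D (h *\<^sub>R v, h))) (at s within S)"
    by (rule has_derivative_compose) (use D in simp)
  moreover have "D (h *\<^sub>R v, h) = (partial_t \<psi> (y s) s + grad_x \<psi> (y s) s \<bullet> v) * h" for h
  proof -
    have "(h *\<^sub>R v, h) = h *\<^sub>R ((v, 0) + (0, 1))" by simp
    then have "D (h *\<^sub>R v, h) = h * (D (v, 0) + D (0, 1))"
      by (simp only: D.scale D.add real_scaleR_def)
    then show ?thesis
      by (simp add: partial_t_eq[OF D] grad_x_inner_eq[OF D] mult.commute add.commute)
  qed
  ultimately show ?thesis by (simp add: has_field_derivative_def)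
qed

text \<open>A barrier argument. \<open>decr\<close> speaks only of times at which \<open>y\<close>
  is in \<open>B\<close>, so it can be verified before it is known that \<open>y\<close> stays
  there.\<close>

lemma sublevel_set_invariant:
  fixes \<psi> :: "(real ^ 'n) \<times> real \<Rightarrow> real"
  assumes \<psi>: "real_polynomial_function \<psi>"
    and ac: "absolutely_continuous_on_interval 0 T y"
    and init: "y 0 \<in> B" "\<psi> (y 0, 0) \<le> 0"
    and "closed B"
    and inner: "\<And>t x. \<lbrakk>t \<in> {0..T}; x \<in> B; \<psi> (x, t) \<le> 0\<rbrakk> \<Longrightarrow> x \<in> interior B"
    and N: "negligible N"
    and decr: "\<And>s. \<lbrakk>s \<in> {0..T} - N; y s \<in> B\<rbrakk> \<Longrightarrow>
      \<exists>v. (y has_vector_derivative v) (at s within {0..T}) \<and>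
          partial_t \<psi> (y s) s + grad_x \<psi> (y s) s \<bullet> v \<le> 0"
    and t: "t \<in> {0..T}"
  shows "y t \<in> B \<and> \<psi> (y t, t) \<le> 0"
proof -
  have cont: "continuous_on {0..T} y"
    using ac_uniformly_continuous[OF ac] by (rule uniformly_continuous_imp_continuous)
  \<comment> \<open>The graph of \<open>y\<close> is compact, which makes \<psi> Lipschitz on it and
    hence absolutely continuous along \<open>y\<close>.\<close>
  have "bounded ((\<lambda>s. (y s, s)) ` {0..T})"
    by (intro compact_imp_bounded compact_continuous_image continuous_intros cont compact_Icc)
  then obtain L where "L-lipschitz_on ((\<lambda>s. (y s, s)) ` {0..T}) \<psi>"
    using real_polynomial_function_lipschitz_on[OF \<psi>] by blast
  then have ac\<psi>: "absolutely_continuous_on_interval 0 T (\<lambda>s. \<psi> (y s, s))"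
    by (rule ac_lipschitz_compose) (intro ac_Pair ac ac_id)
  \<comment> \<open>Conditional on the past: the sign of \<psi> at \<open>t\<close> is obtained from
    membership in \<open>B\<close> up to \<open>t\<close> only, the form that the exit-time argument
    can use.\<close>
  have nonpos: "\<psi> (y t, t) \<le> 0" if t: "t \<in> {0..T}" and inB: "\<And>s. s \<in> {0..t} \<Longrightarrow> y s \<in> B" for t
  proof -
    have "\<psi> (y t, t) \<le> \<psi> (y 0, 0)"
    proof (rule ac_ae_nonpos_derivative_imp_le[where \<phi> = "\<lambda>s. \<psi> (y s, s)", OF _ _ N])
      show "absolutely_continuous_on_interval 0 t (\<lambda>s. \<psi> (y s, s))"
        using t by (intro ac_subset[OF ac\<psi>]) auto
      fix s assume s: "s \<in> {0..t} - N"
      then have "s \<in> {0..T} - N" "y s \<in> B" using t inB by auto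
      from decr[OF this] obtain v where v: "(y has_vector_derivative v) (at s within {0..T})"
        "partial_t \<psi> (y s) s + grad_x \<psi> (y s) s \<bullet> v \<le> 0"
        by blast
      have "(y has_vector_derivative v) (at s within {0..t})"
        using t by (intro has_vector_derivative_within_subset[OF v(1)]) auto
      with v(2) show "\<exists>D\<le>0. ((\<lambda>s. \<psi> (y s, s)) has_real_derivative D) (at s within {0..t})"
        using real_polynomial_derivative_along_curve[OF \<psi>] by blast
    qed (use t in auto)
    with init show ?thesis by linarith
  qed
  have B: "y s \<in> B" if "s \<in> {0..T}" for s
    using cont \<open>closed B\<close> init(1) _ that
  proof (rule continuous_stays_in_closed)
    fix s assume "s \<in> {0..T}" "\<And>r. r \<in> {0..s} \<Longrightarrow> y r \<in> B"
    moreover from this have "\<psi> (y s, s) \<le> 0" by (rule nonpos)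
    moreover have "y s \<in> B" using calculation(1,2) by simp
    ultimately show "y s \<in> interior B" using inner by blast
  qed
  moreover have "\<psi> (y t, t) \<le> 0"
    using t by (intro nonpos B) auto
  ultimately show ?thesis using t by blast
qed

section \<open>What the certificates imply on the ball\<close>

lemma B_set_eq_cball: "B_set R = cball (0 :: real ^ 'n) (sqrt R)"
  by (auto simp: B_set_def g_ball_def norm_vec_def L2_set_def)

lemma sos_nonneg: "sos p \<Longrightarrow> 0 \<le> p z"
  unfolding sos_def by (auto intro!: sum_nonneg)

text \<open>The multipliers are sums of squares, and their cofactors \<open>g_ball R x\<close>,
  \<open>t * (T - t)\<close> and \<open>h r d\<close> are nonnegative on the ball, the time interval
  and the disturbance set, so each right-hand side is nonnegative.\<close>

lemma SOS_constraints_imp: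
  assumes "SOS_constraints f T R nD h nX g nTR l \<psi>" and x: "x \<in> B_set R"
  shows "\<lbrakk>t \<in> {0..T}; d \<in> disturbance_set nD h\<rbrakk> \<Longrightarrow>
      partial_t \<psi> x t + grad_x \<psi> x t \<bullet> f (x, d) \<le> 0"
    and "\<lbrakk>t \<in> {0..T}; \<psi> (x, t) \<le> 0\<rbrakk> \<Longrightarrow> x \<in> state_set nX g t"
    and "\<psi> (x, T) \<le> 0 \<Longrightarrow> x \<in> target_set nTR l"
proof -
  obtain s0 s1 s2 :: "(real ^ 'a) \<times> real \<times> (real ^ 'b) \<Rightarrow> real" and s' s3 s4 s5 s6 s7
    where sos: "sos s0" "sos s1" "sos s2" "\<forall>r\<in>{1..nD}. sos (s' r)"
      "\<forall>i\<in>{1..nX}. sos (s3 i) \<and> sos (s4 i) \<and> sos (s5 i)"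
      "\<forall>j\<in>{1..nTR}. sos (s6 j) \<and> sos (s7 j)"
    and deriv: "\<forall>x t d. - (partial_t \<psi> x t + grad_x \<psi> x t \<bullet> f (x, d)) =
           s0 (x, t, d) + s1 (x, t, d) * g_ball R x + s2 (x, t, d) * (t * (T - t))
           + (\<Sum>r\<in>{1..nD}. s' r (x, t, d) * h r d)"
    and state: "\<forall>i\<in>{1..nX}. \<forall>x t. \<psi> (x, t) - g i (x, t) =
           s3 i (x, t) + s4 i (x, t) * g_ball R x + s5 i (x, t) * (t * (T - t))"
    and target: "\<forall>j\<in>{1..nTR}. \<forall>x. \<psi> (x, T) - l j x = s6 j x + s7 j x * g_ball R x"
    using assms(1) unfolding SOS_constraints_def by (elim exE conjE) (rule that)
  have gR: "0 \<le> g_ball R x" using x by (simp add: B_set_def)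
  show "partial_t \<psi> x t + grad_x \<psi> x t \<bullet> f (x, d) \<le> 0"
    if "t \<in> {0..T}" "d \<in> disturbance_set nD h"
  proof -
    have "0 \<le> (\<Sum>r\<in>{1..nD}. s' r (x, t, d) * h r d)"
      using that(2) sos(4) by (intro sum_nonneg mult_nonneg_nonneg) (auto simp: disturbance_set_def sos_nonneg)
    moreover have "0 \<le> s0 (x, t, d)" "0 \<le> s1 (x, t, d) * g_ball R x" "0 \<le> s2 (x, t, d) * (t * (T - t))"
      using that(1) gR sos(1-3) by (simp_all add: sos_nonneg)
    ultimately show ?thesis using deriv[rule_format, of x t d] by linarith
  qed
  show "x \<in> state_set nX g t" if "t \<in> {0..T}" "\<psi> (x, t) \<le> 0"
    unfolding state_set_def
  proof (intro CollectI ballI)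
    fix i assume i: "i \<in> {1..nX}"
    have "0 \<le> s3 i (x, t)" "0 \<le> s4 i (x, t) * g_ball R x" "0 \<le> s5 i (x, t) * (t * (T - t))"
      using that(1) gR bspec[OF sos(5) i] by (simp_all add: sos_nonneg)
    then show "g i (x, t) \<le> 0" using state[rule_format, OF i, of x t] that(2) by linarith
  qed
  show "x \<in> target_set nTR l" if "\<psi> (x, T) \<le> 0"
    unfolding target_set_def
  proof (intro CollectI ballI)
    fix j assume j: "j \<in> {1..nTR}"
    have "0 \<le> s6 j x" "0 \<le> s7 j x * g_ball R x"
      using gR bspec[OF sos(6) j] by (simp_all add: sos_nonneg)
    then show "l j x \<le> 0" using target[rule_format, OF j, of x] that by linarith
  qed
qed

text \<open>Where no constraint is active, all are strict, and by continuity a whole neighbourhood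
  lies in the state set and so in \<open>B\<close>. Only points of \<open>state_boundary\<close>
  could touch the frontier, and \<open>bd\<close> excludes these.\<close>

lemma state_set_subset_interior:
  assumes g: "\<And>i. i \<in> {1..nX} \<Longrightarrow> real_polynomial_function (g i)"
    and sub: "state_set nX g t \<subseteq> B" and "closed B"
    and bd: "state_boundary nX g t \<inter> frontier B = {}"
  shows "state_set nX g t \<subseteq> interior B"
proof
  fix x assume x: "x \<in> state_set nX g t"
  show "x \<in> interior B"
  proof (rule ccontr)
    assume "x \<notin> interior B"
    then have "x \<in> frontier B" using x sub \<open>closed B\<close> by (auto simp: frontier_def)
    then have "x \<notin> state_boundary nX g t" using bd by blast
    then have "x \<in> (\<Inter>i\<in>{1..nX}. {z. g i (z, t) < 0})"
      using x by (force simp: state_boundary_def state_set_def)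
    moreover have "open (\<Inter>i\<in>{1..nX}. {z. g i (z, t) < 0})"
    proof (intro open_INT ballI open_Collect_less continuous_on_const)
      fix i assume "i \<in> {1..nX}"
      then have "continuous_on UNIV (g i)"
        using g by (simp add: continuous_at_imp_continuous_on continuous_real_polymonial_function)
      then show "continuous_on UNIV (\<lambda>z. g i (z, t))"
        by (rule continuous_on_compose2[OF _ continuous_on_Pair[OF continuous_on_id continuous_on_const]]) simp
    qed simp
    moreover have "(\<Inter>i\<in>{1..nX}. {z. g i (z, t) < 0}) \<subseteq> B"
      using sub by (force simp: state_set_def)
    ultimately show False using \<open>x \<notin> interior B\<close> interior_maximal by blast
  qed
qed

section \<open>The projected equation\<close>

text \<open>The nearest-point map onto a closed convex set is nonexpansive, so the bound and the
  Lipschitz constant of \<open>f\<close> on the compact set \<open>B \<times> D\<close> carry over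
  to the projected field on the whole space.\<close>

lemma projected_solution_exists:
  fixes f :: "(real ^ 'n) \<times> (real ^ 'm) \<Rightarrow> real ^ 'n"
  assumes f: "\<And>i. real_polynomial_function (\<lambda>z. f z $ i)"
    and B: "compact B" "convex B" "B \<noteq> {}" and D: "compact D"
    and d: "d \<in> admissible_inputs T D" and "T \<ge> 0"
  obtains y N where "y 0 = x0" "absolutely_continuous_on_interval 0 T y" "negligible N"
    "\<And>s. s \<in> {0..T} - N \<Longrightarrow>
       (y has_vector_derivative f (closest_point B (y s), d s)) (at s within {0..T})"
proof -
  have dD: "d s \<in> D" if "s \<in> {0..T}" for s
    using d that by (simp add: admissible_inputs_def)
  have d_meas: "d \<in> borel_measurable (lebesgue_on {0..T})"
    using d by (simp add: admissible_inputs_def)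
  define F where "F s x = f (closest_point B x, d s)" for s x
  have cp: "closest_point B x \<in> B" for x
    using B by (intro closest_point_in_set) (auto simp: compact_imp_closed)
  have bd: "bounded (B \<times> D)" using B D by (intro bounded_Times compact_imp_bounded)
  then obtain L where L: "L-lipschitz_on (B \<times> D) f"
    using polynomial_components_lipschitz_on[OF f] by blast
  then have "bounded (f ` (B \<times> D))"
    using bd by (intro bounded_uniformly_continuous_image lipschitz_on_uniformly_continuous)
  then obtain M where "M > 0" and M: "\<And>z. z \<in> B \<times> D \<Longrightarrow> norm (f z) \<le> M"
    unfolding bounded_pos by blast
  have F_lip: "L-lipschitz_on UNIV (F s)" if "s \<in> {0..T}" for s
  proof (rule lipschitz_onI)
    fix x y :: "real ^ 'n"
    have "dist (F s x) (F s y) \<le> L * dist (closest_point B x, d s) (closest_point B y, d s)"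
      unfolding F_def using cp dD[OF that] by (intro lipschitz_onD[OF L]) auto
    also have "\<dots> \<le> L * dist x y"
      using closest_point_lipschitz[OF B(2) _ B(3)] B(1) lipschitz_on_nonneg[OF L]
      by (intro mult_left_mono) (auto simp: dist_Pair_Pair compact_imp_closed)
    finally show "dist (F s x) (F s y) \<le> L * dist x y" .
  qed (rule lipschitz_on_nonneg[OF L])
  have F_bound: "norm (F s x) \<le> M" if "s \<in> {0..T}" for s x
    unfolding F_def using cp dD[OF that] by (intro M) auto
  have f_cont: "continuous_on UNIV f"
  proof -
    have "continuous_on UNIV (\<lambda>z. f z $ i)" for i
      using continuous_real_polymonial_function[OF f] by (simp add: continuous_at_imp_continuous_on)
    then have "continuous_on UNIV (\<lambda>z. \<chi> i. f z $ i)" by (rule continuous_on_vec_lambda)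
    then show ?thesis by simp
  qed
  have F_meas: "(\<lambda>s. F s (y s)) \<in> borel_measurable (lebesgue_on {0..T})"
    if "continuous_on UNIV y" for y
  proof -
    have "continuous_on {0..T} (\<lambda>s. closest_point B (y s))"
      by (rule continuous_on_compose2[OF continuous_on_closest_point[where t = UNIV,
            OF B(2) compact_imp_closed[OF B(1)] B(3)] continuous_on_subset[OF that]]) simp_all
    then have "(\<lambda>s. closest_point B (y s)) \<in> borel_measurable (lebesgue_on {0..T})"
      by (rule continuous_imp_measurable_on_sets_lebesgue) auto
    then show ?thesis
      unfolding F_def
      by (rule borel_measurable_continuous_on[OF f_cont borel_measurable_Pair[OF _ d_meas]])
  qed
  obtain z where z: "continuous_on UNIV z"
    "\<And>t. t \<in> {0..T} \<Longrightarrow> z t = x0 + integral {0..t} (\<lambda>s. F s (z s))"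
    by (rule caratheodory_solution_exists[OF \<open>T \<ge> 0\<close> F_lip F_bound F_meas, where ?x0.0 = x0]) (assumption | rule that)+
  \<comment> \<open>Literally an indefinite integral, so that the Lipschitz and differentiation
    results apply; it is known to agree with \<open>z\<close> only on \<open>{0..T}\<close>.\<close>
  define y where "y = (\<lambda>t. x0 + integral {0..t} (\<lambda>s. F s (z s)))"
  have yz: "y t = z t" if "t \<in> {0..T}" for t using z(2)[OF that] by (simp add: y_def)
  obtain N where N: "negligible N" "\<And>t. t \<in> {0..T} - N \<Longrightarrow>
      ((\<lambda>t. x0 + integral {0..t} (\<lambda>s. F s (z s))) has_vector_derivative F t (z t))
        (at t within {0..T})"
    by (rule indefinite_integral_has_vector_derivative_ae[OF F_meas[OF z(1)] F_bound, where ?x0.0 = x0])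
      (assumption | rule that)+
  show thesis
  proof (rule that)
    show "y 0 = x0" by (simp add: y_def)
    have "M-lipschitz_on {0..T} y"
      unfolding y_def using F_meas[OF z(1)] F_bound \<open>M > 0\<close>
      by (intro indefinite_integral_lipschitz) auto
    then show "absolutely_continuous_on_interval 0 T y" by (rule lipschitz_imp_ac)
    show "(y has_vector_derivative f (closest_point B (y s), d s)) (at s within {0..T})"
      if "s \<in> {0..T} - N" for s
      using N(2)[OF that, folded y_def] yz[of s] that by (simp add: F_def)
  qed (rule N(1))
qed

theorem corollary2:
  fixes f :: "(real ^ 'n) \<times> (real ^ 'm) \<Rightarrow> real ^ 'n"
    and h :: "nat \<Rightarrow> real ^ 'm \<Rightarrow> real"
    and g :: "nat \<Rightarrow> (real ^ 'n) \<times> real \<Rightarrow> real"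
    and l :: "nat \<Rightarrow> real ^ 'n \<Rightarrow> real"
    and \<psi> :: "(real ^ 'n) \<times> real \<Rightarrow> real"
    and nD nX nTR :: nat
    and T R :: real
  assumes "T > 0"
    and "R > 0"
    and "\<And>i. real_polynomial_function (\<lambda>z. f z $ i)"
    and "\<And>i. i \<in> {1..nD} \<Longrightarrow> real_polynomial_function (h i)"
    and "disturbance_set nD h \<noteq> {}"
    and "compact (disturbance_set nD h)"
    and "\<And>i. i \<in> {1..nX} \<Longrightarrow> real_polynomial_function (g i)"
    and "\<And>t. t \<in> {0..T} \<Longrightarrow> compact (state_set nX g t)"
    and "\<And>j. j \<in> {1..nTR} \<Longrightarrow> real_polynomial_function (l j)"
    and "\<And>t. t \<in> {0..T} \<Longrightarrow> state_set nX g t \<subseteq> B_set R"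
    and "\<And>t. t \<in> {0..T} \<Longrightarrow> state_boundary nX g t \<inter> frontier (B_set R) = {}"
    and "real_polynomial_function \<psi>"
    and "SOS_constraints f T R nD h nX g nTR l \<psi>"
  shows "{x \<in> B_set R. \<psi> (x, 0) \<le> 0} \<subseteq>
    backward_reachable_set f T (disturbance_set nD h) (state_set nX g) (target_set nTR l)"
proof
  fix x0 assume "x0 \<in> {x \<in> B_set R. \<psi> (x, 0) \<le> 0}"
  then have x0: "x0 \<in> B_set R" "\<psi> (x0, 0) \<le> 0" by auto
  let ?B = "B_set R :: (real ^ 'n) set" and ?D = "disturbance_set nD h"
  have B: "compact ?B" "convex ?B" "?B \<noteq> {}" "closed ?B"
    using x0(1) \<open>R > 0\<close> by (auto simp: B_set_eq_cball)
  have inner: "x \<in> interior ?B" if "t \<in> {0..T}" "x \<in> ?B" "\<psi> (x, t) \<le> 0" for t x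
    using state_set_subset_interior[OF assms(7,10) B(4) assms(11)]
      SOS_constraints_imp(2)[OF assms(13)] that by blast
  \<comment> \<open>The equation is assumed only while \<open>y s\<close> is in the ball, so that
    the projected solution is covered too.\<close>
  have invariant: "y t \<in> ?B \<and> \<psi> (y t, t) \<le> 0"
    if "y 0 = x0" "absolutely_continuous_on_interval 0 T y" "d \<in> admissible_inputs T ?D"
      "negligible N" "\<And>s. \<lbrakk>s \<in> {0..T} - N; y s \<in> ?B\<rbrakk> \<Longrightarrow>
        (y has_vector_derivative f (y s, d s)) (at s within {0..T})" "t \<in> {0..T}"
    for y d N t
    using assms(12) that(2) _ _ B(4) inner that(4) _ that(6)
  proof (rule sublevel_set_invariant)
    fix s assume s: "s \<in> {0..T} - N" "y s \<in> ?B"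
    then have "d s \<in> ?D" using that(3) by (auto simp: admissible_inputs_def)
    then have "partial_t \<psi> (y s) s + grad_x \<psi> (y s) s \<bullet> f (y s, d s) \<le> 0"
      using s by (intro SOS_constraints_imp(1)[OF assms(13)]) auto
    with that(5)[OF s] show "\<exists>v. (y has_vector_derivative v) (at s within {0..T}) \<and>
        partial_t \<psi> (y s) s + grad_x \<psi> (y s) s \<bullet> v \<le> 0" by blast
  qed (use x0 that(1) in auto)
  have ae: "(AE s in lebesgue_on {0..T}. P s) \<longleftrightarrow> (\<exists>N. negligible N \<and> (\<forall>s\<in>{0..T} - N. P s))" for P
    by (rule AE_lebesgue_on_iff_negligible) simp
  show "x0 \<in> backward_reachable_set f T ?D (state_set nX g) (target_set nTR l)"
    unfolding backward_reachable_set_def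
  proof (intro CollectI ballI conjI allI impI)
    fix d assume d: "d \<in> admissible_inputs T ?D"
    obtain y N where y: "y 0 = x0" "absolutely_continuous_on_interval 0 T y" "negligible N"
      "\<And>s. s \<in> {0..T} - N \<Longrightarrow>
         (y has_vector_derivative f (closest_point ?B (y s), d s)) (at s within {0..T})"
      using projected_solution_exists[OF assms(3) B(1-3) assms(6) d] \<open>T > 0\<close> by (metis less_imp_le)
    \<comment> \<open>Projection fixes the points of the ball, so there the projected equation is
      the original one. Invariance then keeps \<open>y\<close> in the ball and makes it a genuine
      trajectory.\<close>
    have "(y has_vector_derivative f (y s, d s)) (at s within {0..T})"
      if "s \<in> {0..T} - N" "y s \<in> ?B" for s
      using y(4)[OF that(1)] that(2) by (simp add: closest_point_self)
    then have "is_trajectory f T d x0 y"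
      unfolding is_trajectory_def ae
      using y(1-3) invariant[OF y(1,2) d y(3)] by (intro conjI exI[of _ N]) auto
    then show "\<exists>y. is_trajectory f T d x0 y" by blast
  next
    fix d y assume d: "d \<in> admissible_inputs T ?D" and "is_trajectory f T d x0 y"
    then obtain N where y: "y 0 = x0" "absolutely_continuous_on_interval 0 T y" "negligible N"
      "\<And>s. s \<in> {0..T} - N \<Longrightarrow> (y has_vector_derivative f (y s, d s)) (at s within {0..T})"
      unfolding is_trajectory_def ae by auto
    have inv: "y t \<in> ?B \<and> \<psi> (y t, t) \<le> 0" if "t \<in> {0..T}" for t
      using y(4) that by (intro invariant[OF y(1,2) d y(3)])
    show "y s \<in> state_set nX g s" if "s \<in> {0..T}" for s
      using inv[OF that] that SOS_constraints_imp(2)[OF assms(13)] by blast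
    show "y T \<in> target_set nTR l"
      using inv[of T] \<open>T > 0\<close> SOS_constraints_imp(3)[OF assms(13)] by auto
  qed
qed

end
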